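(* Let $a,b,c,d\ge 1$ be integers, let $H(a,b,c,d)$ be the H-shape tree having two adjacent degree-$3$ vertices $u$ and $v$, where the two pendant paths incident with $u$ have lengths $a$ and $b$, and the two pendant paths incident with $v$ have lengths $c$ and $d$, and put $n=a+b+c+d+2$. Then $$P^\times_{H(a,b,c,d)}(z)=Az^n+Bz^{n-1}+Cz^{n-2},$$ where \begin{align*} A&=J_{a+b+2}J_{c+d+2}+2J_{a+1}J_{b+1}J_{c+1}J_{d+1},\\ B&=J_{a+b+1}J_{c+d+2}+J_{a+b+2}J_{c+d+1}-J_{a+1}J_{b+1}J_{c+1}J_{d+1},\\ C&=J_{a+b+1}J_{c+d+1}-J_{a+1}J_{b+1}J_{c+1}J_{d+1}, \end{align*} and $J_k$ denotes the $k$th Jacobsthal number.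
   Context: All graphs are finite, simple and undirected. For a graph $G=(V,E)$ with $V=\{v_1,\dots,v_n\}$ and a subset $L\subseteq V$, let $\mathbf{A}_{(G,L)}=(a_{ij})$ be the $n\times n$ matrix over $\mathrm{GF}(2)$ with $a_{ij}=1$ if $i\neq j$ and $v_iv_j\in E$, $a_{ii}=1$ if $v_i\in L$, and all other entries $0$. Its corank is $\operatorname{corank}(\mathbf{A}_{(G,L)})=n-\operatorname{rank}(\mathbf{A}_{(G,L)})$, the rank being taken over $\mathrm{GF}(2)$. The partial Petrial polynomial of $G$ is the integer polynomial $$P_G^\times(z)=\sum_{L\subseteq V} z^{\,n-\operatorname{corank}(\mathbf{A}_{(G,L)})}.$$ The length of a path is its number of edges. $H(a,b,c,d)$ is the tree consisting of an edge $uv$ together with two pendant paths with $a$ and $b$ edges having one endpoint at $u$, and two pendant paths with $c$ and $d$ edges having one endpoint at $v$; it has $a+b+c+d+2$ vertices. The Jacobsthal numbers are defined by $J_0=0$, $J_1=1$, $J_k=J_{k-1}+2J_{k-2}$ for $k\ge2$; equivalently $J_k=\frac{2^k-(-1)^k}{3}$ for $k\ge 0$. *)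

theory Defs
  imports
    "HOL-Library.Z2"
    "HOL-Computational_Algebra.Polynomial"
    "Jordan_Normal_Form.DL_Rank"
begin

definition simple_graph :: "'a set \<Rightarrow> 'a set set \<Rightarrow> bool" where
  "simple_graph V E \<longleftrightarrow> finite V \<and> (\<forall>e\<in>E. \<exists>x\<in>V. \<exists>y\<in>V. x \<noteq> y \<and> e = {x, y})"

text \<open>
  The vertices of a graph are enumerated by a distinct list \<open>vs\<close>, which fixes the order
  of rows and columns; edges are two-element sets of vertices. The type \<^typ>\<open>bit\<close> is
  the field of two elements.
\<close>

definition looped_adj_mat :: "'a list \<Rightarrow> 'a set set \<Rightarrow> 'a set \<Rightarrow> bit mat" where
  "looped_adj_mat vs E L =
     mat (length vs) (length vs)
       (\<lambda>(i, j). if i = j then of_bool (vs ! i \<in> L) else of_bool ({vs ! i, vs ! j} \<in> E))"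

definition corank :: "'a::field mat \<Rightarrow> nat" where
  "corank M = dim_row M - vec_space.rank (dim_row M) M"

definition partial_petrial_poly :: "'a list \<Rightarrow> 'a set set \<Rightarrow> int poly" where
  "partial_petrial_poly vs E =
     (\<Sum>L\<in>Pow (set vs). monom 1 (length vs - corank (looped_adj_mat vs E L)))"

definition path_edges :: "'a list \<Rightarrow> 'a set set" where
  "path_edges xs = {{xs ! i, xs ! Suc i} | i. Suc i < length xs}"

text \<open>
  The lists \<open>p\<close>, \<open>q\<close>, \<open>r\<close>, \<open>s\<close> hold the vertices of the pendant paths other than
  their endpoint at \<open>u\<close> or \<open>v\<close>, so the length of such a list is the number of edges
  of the path. The predicate describes all graphs of this shape, on any vertex type.
\<close>

definition H_shape :: "nat \<Rightarrow> nat \<Rightarrow> nat \<Rightarrow> nat \<Rightarrow> 'a set \<Rightarrow> 'a set set \<Rightarrow> bool" where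
  "H_shape a b c d V E \<longleftrightarrow>
     (\<exists>u v p q r s.
        length p = a \<and> length q = b \<and> length r = c \<and> length s = d \<and>
        distinct (u # v # p @ q @ r @ s) \<and>
        V = set (u # v # p @ q @ r @ s) \<and>
        E = {{u, v}} \<union> path_edges (u # p) \<union> path_edges (u # q)
                     \<union> path_edges (v # r) \<union> path_edges (v # s))"

lemma path_edges_simple:
  assumes "distinct xs" "set xs \<subseteq> V" "e \<in> path_edges xs"
  shows "\<exists>x\<in>V. \<exists>y\<in>V. x \<noteq> y \<and> e = {x, y}"
proof -
  from assms(3) obtain i where i: "Suc i < length xs" "e = {xs ! i, xs ! Suc i}"
    unfolding path_edges_def by blast
  then have "xs ! i \<in> V" "xs ! Suc i \<in> V"
    using assms(2) by (meson Suc_lessD nth_mem subsetD)+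
  moreover have "xs ! i \<noteq> xs ! Suc i"
    using assms(1) i(1) by (simp add: nth_eq_iff_index_eq)
  ultimately show ?thesis using i(2) by blast
qed

lemma H_shape_simple_graph:
  assumes "H_shape a b c d V E"
  shows "simple_graph V E"
proof -
  from assms obtain u v p q r s where
    dist: "distinct (u # v # p @ q @ r @ s)" and V: "V = set (u # v # p @ q @ r @ s)" and
    E: "E = {{u, v}} \<union> path_edges (u # p) \<union> path_edges (u # q)
                     \<union> path_edges (v # r) \<union> path_edges (v # s)"
    unfolding H_shape_def by blast
  have "\<exists>x\<in>V. \<exists>y\<in>V. x \<noteq> y \<and> e = {x, y}" if e: "e \<in> E" for e
  proof -
    consider "e = {u, v}" | "e \<in> path_edges (u # p)" | "e \<in> path_edges (u # q)"
      | "e \<in> path_edges (v # r)" | "e \<in> path_edges (v # s)"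
      using e E by blast
    then show ?thesis
    proof cases
      case 1
      moreover have "u \<noteq> v" "u \<in> V" "v \<in> V" using dist V by auto
      ultimately show ?thesis by blast
    next
      case 2
      then show ?thesis by (rule path_edges_simple[rotated 2]) (use dist V in auto)
    next
      case 3
      then show ?thesis by (rule path_edges_simple[rotated 2]) (use dist V in auto)
    next
      case 4
      then show ?thesis by (rule path_edges_simple[rotated 2]) (use dist V in auto)
    next
      case 5
      then show ?thesis by (rule path_edges_simple[rotated 2]) (use dist V in auto)
    qed
  qed
  then show ?thesis unfolding simple_graph_def using V by simp
qed

lemma H_shape_card:
  assumes "H_shape a b c d V E"
  shows "card V = a + b + c + d + 2"
proof -
  from assms obtain u v p q r s where
    len: "length p = a" "length q = b" "length r = c" "length s = d" and
    dist: "distinct (u # v # p @ q @ r @ s)" and V: "V = set (u # v # p @ q @ r @ s)"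
    unfolding H_shape_def by blast
  have "card V = length (u # v # p @ q @ r @ s)"
    unfolding V using dist by (rule distinct_card)
  then show ?thesis using len by simp
qed

lemma H_shape_exists: "\<exists>(V :: nat set) E. H_shape a b c d V E"
proof -
  let ?p = "[2..<2+a]" and ?q = "[2+a..<2+a+b]" and ?r = "[2+a+b..<2+a+b+c]"
    and ?s = "[2+a+b+c..<2+a+b+c+d]"
  have "distinct (0 # 1 # ?p @ ?q @ ?r @ ?s)" by auto
  moreover have "length ?p = a" "length ?q = b" "length ?r = c" "length ?s = d" by auto
  ultimately show ?thesis unfolding H_shape_def by blast
qed

fun jacobsthal :: "nat \<Rightarrow> int" where
  "jacobsthal 0 = 0"
| "jacobsthal (Suc 0) = 1"
| "jacobsthal (Suc (Suc k)) = jacobsthal (Suc k) + 2 * jacobsthal k"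

end

theory Submission
  imports Defs
begin

text \<open>
  Write \<open>z\<close> for the variable and \<open>Q(G)\<close> for the sum of \<open>z ^ rank\<close> over all choices of loops, which
  is the polynomial in question because \<open>n - corank\<close> is the rank. If \<open>x\<close> is a leaf at \<open>y\<close>, then
  eliminating \<open>x\<close> over GF(2) gives

    \<open>Q(G) = z * Q(G - x) + 2 * z^2 * Q(G - x - y)\<close>

  (\<open>petrial_on_leaf\<close>): a looped leaf contributes rank 1 and toggles the loop at \<open>y\<close>, which permutes
  the loop sets of \<open>G - x\<close>; an unlooped leaf forms with \<open>y\<close> an invertible \<open>2 \<times> 2\<close> block. An
  isolated vertex gives a factor \<open>1 + z\<close>.

  This is the Jacobsthal recursion with powers of \<open>z\<close>: hanging a path with \<open>k\<close> vertices at \<open>u\<close>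
  multiplies by \<open>z^k\<close> and replaces \<open>Q(G)\<close> by \<open>J(k+1) * Q(G) + 2 * z * J(k) * Q(G - u)\<close>
  (\<open>petrial_on_pendant_path\<close>). Two paths of lengths \<open>a\<close> and \<open>b\<close> at the same vertex \<open>u\<close> therefore
  replace \<open>Q(G)\<close>, up to the factor \<open>z^(a+b)\<close>, by

    \<open>m * Q(G) + ((J(a+b+2) - m) * z + (J(a+b+1) - m)) * Q(G - u)\<close>  where  \<open>m = J(a+1) * J(b+1)\<close>

  (\<open>petrial_on_two_pendant_paths\<close>). Using this at \<open>u\<close> and then at \<open>v\<close> reduces the H-shape tree to the
  induced subgraphs of the single edge \<open>uv\<close>, whose polynomials are \<open>3 * z^2 + z\<close>, \<open>1 + z\<close> and
  \<open>1\<close>; expanding the product gives the three coefficients.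

  The elimination steps are carried out on kernels. Over GF(2) a kernel vector is a set of vertices,
  a kernel of dimension \<open>k\<close> has \<open>2^k\<close> elements, and \<open>|ker| * 2 ^ rank = 2 ^ n\<close>
  (\<open>card_kernel_sets_rank\<close>). So a bijection between two kernels compares two ranks, without row
  operations, block decompositions or reorderings of the vertices.
\<close>

section \<open>Ranks over a finite field as cardinalities\<close>

text \<open>
  Coordinates with respect to a basis are a bijection between the space and the coefficient
  functions on that basis.
\<close>

lemma (in vectorspace) card_carrier_finite_field:
  assumes "fin_dim" and "finite (carrier K)"
  shows "card (carrier V) = card (carrier K) ^ dim"
proof -
  obtain B where B: "finite B" "basis B"
    using finite_basis_exists[OF assms(1)] by blast
  have BV: "B \<subseteq> carrier V" and li: "lin_indpt B" and gen: "span B = carrier V"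
    using B(2) unfolding basis_def by auto
  have "bij_betw (\<lambda>f. lincomb f B) (B \<rightarrow>\<^sub>E carrier K) (carrier V)"
  proof (rule bij_betw_imageI)
    show "inj_on (\<lambda>f. lincomb f B) (B \<rightarrow>\<^sub>E carrier K)"
    proof (rule inj_onI)
      fix f g assume f: "f \<in> B \<rightarrow>\<^sub>E carrier K" and g: "g \<in> B \<rightarrow>\<^sub>E carrier K"
        and eq: "lincomb f B = lincomb g B"
      have fg: "f \<in> B \<rightarrow> carrier K" "g \<in> B \<rightarrow> carrier K" using f g by (auto simp: PiE_def)
      have "lincomb (\<lambda>v. f v \<ominus>\<^bsub>K\<^esub> g v) B = lincomb f B \<ominus>\<^bsub>V\<^esub> lincomb g B"
        by (rule lincomb_diff) (use B(1) BV fg in auto)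
      also have "\<dots> = \<zero>\<^bsub>V\<^esub>"
        unfolding eq using lincomb_closed[OF BV fg(2)] M.r_neg[of "lincomb g B"]
        by (simp add: a_minus_def)
      finally have diff: "(\<lambda>v. f v \<ominus>\<^bsub>K\<^esub> g v) \<in> B \<rightarrow> {\<zero>\<^bsub>K\<^esub>}"
        by (intro not_lindepD[OF li B(1) subset_refl]) (use fg in auto)
      have "f v = g v" if "v \<in> B" for v
      proof -
        have v: "f v \<in> carrier K" "g v \<in> carrier K" using that fg by auto
        have "f v \<oplus>\<^bsub>K\<^esub> \<ominus>\<^bsub>K\<^esub> g v = \<zero>\<^bsub>K\<^esub>"
          using diff that by (simp add: Pi_iff a_minus_def)
        then show ?thesis
          using R.minus_equality[of "f v" "\<ominus>\<^bsub>K\<^esub> g v"] v R.minus_minus[of "g v"] by simp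
      qed
      with f g show "f = g" by (rule PiE_ext)
    qed
    show "(\<lambda>f. lincomb f B) ` (B \<rightarrow>\<^sub>E carrier K) = carrier V"
    proof (intro subset_antisym subsetI)
      fix v assume "v \<in> (\<lambda>f. lincomb f B) ` (B \<rightarrow>\<^sub>E carrier K)"
      then obtain f where "v = lincomb f B" "f \<in> B \<rightarrow> carrier K" by (auto simp: PiE_def)
      then show "v \<in> carrier V" using lincomb_closed[OF BV] by simp
    next
      fix v assume v: "v \<in> carrier V"
      then obtain f where f: "f \<in> B \<rightarrow> carrier K" "lincomb f B = v"
        using finite_in_span[OF B(1) BV, of v] unfolding gen by blast
      have "lincomb (restrict f B) B = v"
        unfolding f(2)[symmetric] using f(1) by (intro lincomb_cong[OF refl BV]) auto
      moreover have "restrict f B \<in> B \<rightarrow>\<^sub>E carrier K"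
        using f(1) by auto
      ultimately show "v \<in> (\<lambda>f. lincomb f B) ` (B \<rightarrow>\<^sub>E carrier K)" by blast
    qed
  qed
  then have "card (carrier V) = card (B \<rightarrow>\<^sub>E carrier K)"
    by (simp add: bij_betw_same_card)
  also have "\<dots> = card (carrier K) ^ card B" using B(1) by (simp add: card_PiE)
  also have "card B = dim" using dim_basis[OF B] by simp
  finally show ?thesis .
qed

context vec_space
begin

lemma card_carrier_vec_finite_field:
  assumes "finite (UNIV :: 'a set)"
  shows "card (carrier_vec n :: 'a vec set) = card (UNIV :: 'a set) ^ n"
  using card_carrier_finite_field[OF fin_dim] assms dim_is_n
  by simp

lemma card_col_space:
  assumes "finite (UNIV :: 'a set)" and A: "A \<in> carrier_mat n nc"
  shows "card (col_space A) = card (UNIV :: 'a set) ^ rank A"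
proof -
  have cols: "set (cols A) \<subseteq> carrier_vec n" using cols_dim[of A] A by auto
  interpret S: vectorspace class_ring "span_vs (set (cols A))"
    using span_is_subspace[OF cols] by (rule subspace_is_vs)
  show ?thesis
    using S.card_carrier_finite_field[OF fin_dim_span_cols[OF A]] assms(1)
    by (simp add: rank_def col_space_def)
qed

end

text \<open>
  Rank-nullity in counting form: every nonempty fibre of \<open>x \<mapsto> A x\<close> is a translate of the kernel.
\<close>

lemma card_kernel_mult_card_image:
  fixes A :: "'a :: field mat"
  assumes finite: "finite (UNIV :: 'a set)" and A: "A \<in> carrier_mat n m"
  shows "card {x \<in> carrier_vec m. A *\<^sub>v x = 0\<^sub>v n} * card ((\<lambda>x. A *\<^sub>v x) ` carrier_vec m)
       = card (carrier_vec m :: 'a vec set)"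
proof -
  have fin: "finite (carrier_vec m :: 'a vec set)"
    using vec_space.card_carrier_vec_finite_field[OF finite, of m] finite
    by (intro card_ge_0_finite) (simp add: finite_UNIV_card_ge_0)
  let ?K = "{x \<in> carrier_vec m. A *\<^sub>v x = 0\<^sub>v n}"
  let ?F = "\<lambda>y. {x \<in> carrier_vec m. A *\<^sub>v x = y}"
  have fibre: "card (?F y) = card ?K" if "y \<in> (\<lambda>x. A *\<^sub>v x) ` carrier_vec m" for y
  proof -
    from that obtain x0 where x0: "x0 \<in> carrier_vec m" "y = A *\<^sub>v x0" by blast
    have "bij_betw (\<lambda>x. x + x0) ?K (?F y)"
    proof (rule bij_betw_byWitness[where f' = "\<lambda>x. x - x0"])
      show "\<forall>a\<in>?K. a + x0 - x0 = a" using x0 by auto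
      show "\<forall>a\<in>?F y. a - x0 + x0 = a" using x0 by auto
      show "(\<lambda>x. x + x0) ` ?K \<subseteq> ?F y"
        using x0 A by (auto simp: mult_add_distrib_mat_vec[OF A])
      show "(\<lambda>x. x - x0) ` ?F y \<subseteq> ?K"
        using x0 A by (auto simp: mult_minus_distrib_mat_vec[OF A])
    qed
    then show ?thesis by (simp add: bij_betw_same_card)
  qed
  have "card (carrier_vec m :: 'a vec set)
      = (\<Sum>y\<in>(\<lambda>x. A *\<^sub>v x) ` carrier_vec m. card (?F y))"
    using sum.image_gen[OF fin, of "\<lambda>_. 1::nat" "\<lambda>x. A *\<^sub>v x"] by simp
  also have "\<dots> = (\<Sum>y\<in>(\<lambda>x. A *\<^sub>v x) ` carrier_vec m. card ?K)"
    by (intro sum.cong refl fibre)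
  finally show ?thesis by simp
qed

lemma finite_UNIV_bit: "finite (UNIV :: bit set)" and card_UNIV_bit: "card (UNIV :: bit set) = 2"
proof -
  have U: "(UNIV :: bit set) = {0, 1}" 
    using bit_not_zero_iff by blast
  show "finite (UNIV :: bit set)" "card (UNIV :: bit set) = 2" unfolding U by simp_all
qed

section \<open>Symmetric matrices over GF(2) indexed by a vertex set\<close>

text \<open>
  Vectors over GF(2) are identified with their supports, so this is the null space of the matrix
  \<open>M\<close> restricted to \<open>V \<times> V\<close>, with no ordering of \<open>V\<close> involved.
\<close>

definition kernel_sets :: "'a set \<Rightarrow> ('a \<Rightarrow> 'a \<Rightarrow> bit) \<Rightarrow> 'a set set" where
  "kernel_sets V M = {X. X \<subseteq> V \<and> (\<forall>v\<in>V. (\<Sum>w\<in>X. M v w) = 0)}"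

text \<open>
  The rank-nullity relation \<open>|ker| * 2 ^ rank = 2 ^ |V|\<close> determines the rank, so it can serve as a
  definition that is free of vertex orderings; existence is proved below from the rank of an
  ordered matrix.
\<close>

definition gf2_rank :: "'a set \<Rightarrow> ('a \<Rightarrow> 'a \<Rightarrow> bit) \<Rightarrow> nat" where
  "gf2_rank V M = (THE r. card (kernel_sets V M) * 2 ^ r = 2 ^ card V)"

lemma gf2_rank_eqI:
  assumes "card (kernel_sets V M) * 2 ^ r = 2 ^ card V"
  shows "gf2_rank V M = r"
  unfolding gf2_rank_def
proof (rule the_equality)
  fix r' assume "card (kernel_sets V M) * 2 ^ r' = 2 ^ card V"
  with assms have "card (kernel_sets V M) * 2 ^ r' = card (kernel_sets V M) * 2 ^ r"
    and "card (kernel_sets V M) \<noteq> 0"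
    by (simp, metis mult_zero_left power_eq_0_iff zero_neq_numeral)
  then show "r' = r" by simp
qed (rule assms)

text \<open>
  Indicator vectors along the enumeration \<open>vs\<close> turn the null sets into the kernel of the matrix,
  and its image is the column space, of cardinality \<open>2 ^ rank\<close>.
\<close>

lemma card_kernel_sets_rank:
  fixes M :: "'a \<Rightarrow> 'a \<Rightarrow> bit"
  assumes "distinct vs"
  defines "n \<equiv> length vs"
  defines "A \<equiv> mat n n (\<lambda>(i, j). M (vs ! i) (vs ! j))"
  shows "card (kernel_sets (set vs) M) * 2 ^ vec_space.rank n A = 2 ^ n"
proof -
  have A: "A \<in> carrier_mat n n" unfolding A_def by simp
  let ?ind = "\<lambda>X. vec n (\<lambda>i. of_bool (vs ! i \<in> X)) :: bit vec"
  have mult: "(A *\<^sub>v ?ind X) $ i = (\<Sum>w\<in>X. M (vs ! i) w)" if "X \<subseteq> set vs" "i < n" for X i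
  proof -
    have bij: "bij_betw ((!) vs) {0..<n} (set vs)"
      using bij_betw_nth[OF assms(1), of "{0..<n}" "set vs"]
      by (simp add: n_def atLeast0LessThan)
    have "(A *\<^sub>v ?ind X) $ i = (\<Sum>j = 0..<n. M (vs ! i) (vs ! j) * of_bool (vs ! j \<in> X))"
      using that(2) by (simp add: A_def scalar_prod_def)
    also have "\<dots> = (\<Sum>w\<in>set vs. M (vs ! i) w * of_bool (w \<in> X))"
      using sum.reindex_bij_betw[OF bij, of "\<lambda>w. M (vs ! i) w * of_bool (w \<in> X)"] by simp
    also have "\<dots> = (\<Sum>w\<in>X. M (vs ! i) w)"
      using that(1) by (intro sum.mono_neutral_cong_right) auto
    finally show ?thesis .
  qed
  have "bij_betw ?ind (kernel_sets (set vs) M) {x \<in> carrier_vec n. A *\<^sub>v x = 0\<^sub>v n}"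
  proof (rule bij_betw_byWitness[where f' = "\<lambda>x. {vs ! i | i. i < n \<and> x $ i = 1}"])
    show "\<forall>X\<in>kernel_sets (set vs) M. {vs ! i | i. i < n \<and> ?ind X $ i = 1} = X"
    proof
      fix X assume "X \<in> kernel_sets (set vs) M"
      then have "X \<subseteq> set vs" by (simp add: kernel_sets_def)
      moreover have "{vs ! i | i. i < n \<and> ?ind X $ i = 1} = {vs ! i | i. i < n \<and> vs ! i \<in> X}"
        by auto
      moreover have "{vs ! i | i. i < n \<and> vs ! i \<in> X} = set vs \<inter> X"
        unfolding n_def set_conv_nth by auto
      ultimately show "{vs ! i | i. i < n \<and> ?ind X $ i = 1} = X" by (simp only: Int_absorb1)
    qed
    have ind_support: "?ind {vs ! i | i. i < n \<and> x $ i = 1} = x" if "x \<in> carrier_vec n" for x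
    proof (rule eq_vecI)
      fix i assume "i < dim_vec x"
      then have i: "i < n" using that by simp
      have "vs ! i \<in> {vs ! j | j. j < n \<and> x $ j = 1} \<longleftrightarrow> x $ i = 1"
        using i nth_eq_iff_index_eq[OF assms(1)] unfolding n_def by auto
      then show "?ind {vs ! j | j. j < n \<and> x $ j = 1} $ i = x $ i"
        using i by (cases "x $ i") simp_all
    qed (use that in simp)
    then show "\<forall>x\<in>{x \<in> carrier_vec n. A *\<^sub>v x = 0\<^sub>v n}.
        ?ind {vs ! i | i. i < n \<and> x $ i = 1} = x" by blast
    show "?ind ` kernel_sets (set vs) M \<subseteq> {x \<in> carrier_vec n. A *\<^sub>v x = 0\<^sub>v n}"
    proof (clarsimp simp: kernel_sets_def)
      fix X assume X: "X \<subseteq> set vs" "\<forall>v\<in>set vs. sum (M v) X = 0"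
      show "A *\<^sub>v ?ind X = 0\<^sub>v n"
        using X A mult[OF X(1)] by (intro eq_vecI) (auto simp: n_def)
    qed
    show "(\<lambda>x. {vs ! i | i. i < n \<and> x $ i = 1}) ` {x \<in> carrier_vec n. A *\<^sub>v x = 0\<^sub>v n}
        \<subseteq> kernel_sets (set vs) M"
    proof (clarify)
      fix x assume x: "x \<in> carrier_vec n" "A *\<^sub>v x = 0\<^sub>v n"
      let ?X = "{vs ! i | i. i < n \<and> x $ i = 1}"
      have X: "?X \<subseteq> set vs" by (auto simp: n_def)
      have "(\<Sum>w\<in>?X. M v w) = 0" if "v \<in> set vs" for v
      proof -
        obtain i where "i < n" "v = vs ! i" using \<open>v \<in> set vs\<close> by (auto simp: in_set_conv_nth n_def)
        then show ?thesis using mult[OF X, of i] ind_support[OF x(1)] x(2) by simp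
      qed
      with X show "?X \<in> kernel_sets (set vs) M" by (simp add: kernel_sets_def)
    qed
  qed
  then have "card (kernel_sets (set vs) M) = card {x \<in> carrier_vec n. A *\<^sub>v x = 0\<^sub>v n}"
    by (rule bij_betw_same_card)
  moreover have "(\<lambda>x. A *\<^sub>v x) ` carrier_vec n = vec_space.col_space n A"
    using vec_space.col_space_eq[OF A] A by auto
  ultimately show ?thesis
    using card_kernel_mult_card_image[OF finite_UNIV_bit A]
      vec_space.card_col_space[OF finite_UNIV_bit A]
      vec_space.card_carrier_vec_finite_field[OF finite_UNIV_bit, of n]
    by (simp add: card_UNIV_bit)
qed

lemma gf2_rank_eq_rank:
  assumes "distinct vs"
  shows "gf2_rank (set vs) M
       = vec_space.rank (length vs) (mat (length vs) (length vs) (\<lambda>(i, j). M (vs ! i) (vs ! j)))"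
  using card_kernel_sets_rank[OF assms, of M] distinct_card[OF assms]
  by (intro gf2_rank_eqI) simp

lemma card_kernel_sets_gf2_rank:
  assumes "finite V"
  shows "card (kernel_sets V M) * 2 ^ gf2_rank V M = 2 ^ card V"
proof -
  obtain vs where vs: "set vs = V" "distinct vs" using finite_distinct_list[OF assms] by blast
  show ?thesis
    using card_kernel_sets_rank[OF vs(2), of M] gf2_rank_eq_rank[OF vs(2), of M]
      distinct_card[OF vs(2)] vs(1) by simp
qed

lemma gf2_rank_cong:
  assumes "\<And>v w. v \<in> V \<Longrightarrow> w \<in> V \<Longrightarrow> M v w = M' v w"
  shows "gf2_rank V M = gf2_rank V M'"
proof -
  have "sum (M v) X = sum (M' v) X" if "v \<in> V" "X \<subseteq> V" for v X
    using that assms by (intro sum.cong) auto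
  then have "kernel_sets V M = kernel_sets V M'"
    unfolding kernel_sets_def by (intro Collect_cong) auto
  then show ?thesis unfolding gf2_rank_def by simp
qed

text \<open>
  The number of null sets is 2 to the power of the nullity. If it stays the same while \<open>k\<close> vertices
  are added, all of \<open>k\<close> goes into the rank.
\<close>

lemma gf2_rank_of_kernel_bij:
  assumes "finite V" "finite W" "bij_betw f (kernel_sets W M') (kernel_sets V M)"
    and "card V = card W + k"
  shows "gf2_rank V M = gf2_rank W M' + k"
proof (rule gf2_rank_eqI)
  have "card (kernel_sets V M) = card (kernel_sets W M')"
    using bij_betw_same_card[OF assms(3)] by simp
  then show "card (kernel_sets V M) * 2 ^ (gf2_rank W M' + k) = 2 ^ card V"
    using card_kernel_sets_gf2_rank[OF assms(2), of M'] assms(4)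
    by (simp add: power_add flip: mult.assoc)
qed

section \<open>Eliminating a vertex with at most one neighbour\<close>

text \<open>
  The row of \<open>x\<close> forces \<open>x\<close> and its neighbour \<open>y\<close> to lie in a null set together. Hence the
  contribution of \<open>x\<close> to the row of \<open>y\<close> can be charged to \<open>y\<close> itself: deleting \<open>x\<close> toggles the
  loop at \<open>y\<close>, and the null sets correspond.
\<close>

lemma gf2_rank_looped_leaf:
  assumes "finite W" "x \<notin> W" "y \<notin> W" "x \<noteq> y"
    and "M x x = 1" "M x y = 1" "M y x = 1"
    and "\<And>w. w \<in> W \<Longrightarrow> M x w = 0" "\<And>w. w \<in> W \<Longrightarrow> M w x = 0"
  shows "gf2_rank (insert x (insert y W)) M
       = gf2_rank (insert y W) (\<lambda>v w. M v w + of_bool (v = y \<and> w = y)) + 1"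
proof -
  let ?V = "insert x (insert y W)" and ?V' = "insert y W"
  let ?M' = "\<lambda>v w. M v w + of_bool (v = y \<and> w = y)"
  let ?f = "\<lambda>T. if y \<in> T then insert x T else T"
  have fin: "finite T" if "T \<subseteq> ?V'" for T
    using finite_subset[OF that] assms(1) by simp
  have sum_x: "sum (M x) T = of_bool (y \<in> T)" if "T \<subseteq> ?V'" for T
  proof -
    have "sum (M x) T = (\<Sum>w\<in>T. if w = y then 1 else 0)"
      using that assms by (intro sum.cong) auto
    then show ?thesis using fin[OF that] by simp
  qed
  have sum': "sum (?M' v) T = sum (M v) T + of_bool (v = y \<and> y \<in> T)" if "T \<subseteq> ?V'" for v T
  proof -
    have "(\<Sum>w\<in>T. of_bool (v = y \<and> w = y)) = (\<Sum>w\<in>T. if w = y then of_bool (v = y) else 0 :: bit)"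
      by (intro sum.cong) auto
    also have "\<dots> = of_bool (v = y \<and> y \<in> T)" using fin[OF that] by simp
    finally show ?thesis by (simp only: sum.distrib)
  qed
  have sum_ins: "sum (M v) (insert x T) = M v x + sum (M v) T" if "T \<subseteq> ?V'" for v T
    using that fin[OF that] assms(2,4) by (subst sum.insert) auto
  \<comment> \<open>Null sets containing \<open>x\<close>, and those avoiding it, in terms of the reduced matrix.\<close>
  have ker_iff: "(\<forall>v\<in>?V. sum (M v) (insert x T) = 0) \<longleftrightarrow> y \<in> T \<and> (\<forall>v\<in>?V'. sum (?M' v) T = 0)"
    if T: "T \<subseteq> ?V'" for T
  proof -
    have "sum (M x) (insert x T) = 0 \<longleftrightarrow> y \<in> T"
      by (simp add: sum_ins[OF T] sum_x[OF T] assms(5))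
    moreover have "sum (M y) (insert x T) = sum (?M' y) T" if "y \<in> T"
      unfolding sum_ins[OF T] sum'[OF T] using that by (simp add: assms(7) add.commute)
    moreover have "sum (M v) (insert x T) = sum (?M' v) T" if "v \<in> W" for v
      unfolding sum_ins[OF T] sum'[OF T] using that assms(3) by (auto simp: assms(9))
    ultimately show ?thesis by auto
  qed
  have ker_iff': "(\<forall>v\<in>?V. sum (M v) T = 0) \<longleftrightarrow> y \<notin> T \<and> (\<forall>v\<in>?V'. sum (?M' v) T = 0)"
    if T: "T \<subseteq> ?V'" for T
  proof -
    have "sum (M y) T = sum (?M' y) T" if "y \<notin> T"
      unfolding sum'[OF T] using that by simp
    moreover have "sum (M v) T = sum (?M' v) T" if "v \<in> W" for v
      unfolding sum'[OF T] using that assms(3) by auto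
    ultimately show ?thesis by (auto simp: sum_x[OF T])
  qed
  have "bij_betw ?f (kernel_sets ?V' ?M') (kernel_sets ?V M)"
  proof (rule bij_betw_byWitness[where f' = "\<lambda>X. X - {x}"])
    show "\<forall>T\<in>kernel_sets ?V' ?M'. ?f T - {x} = T"
      using assms(2,4) by (auto simp: kernel_sets_def)
    have mem: "X - {x} \<in> kernel_sets ?V' ?M' \<and> ?f (X - {x}) = X" if X: "X \<in> kernel_sets ?V M" for X
    proof (cases "x \<in> X")
      case True
      then have "insert x (X - {x}) = X" "X - {x} \<subseteq> ?V'" using X by (auto simp: kernel_sets_def)
      then show ?thesis using X ker_iff[of "X - {x}"] by (auto simp: kernel_sets_def)
    next
      case False
      then have "X - {x} = X" "X \<subseteq> ?V'" using X by (auto simp: kernel_sets_def)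
      then show ?thesis using X ker_iff'[of X] by (auto simp: kernel_sets_def)
    qed
    then show "\<forall>X\<in>kernel_sets ?V M. ?f (X - {x}) = X"
      and "(\<lambda>X. X - {x}) ` kernel_sets ?V M \<subseteq> kernel_sets ?V' ?M'" by blast+
    show "?f ` kernel_sets ?V' ?M' \<subseteq> kernel_sets ?V M"
    proof (rule image_subsetI)
      fix T assume "T \<in> kernel_sets ?V' ?M'"
      then have T: "T \<subseteq> ?V'" "\<forall>v\<in>?V'. sum (?M' v) T = 0" by (auto simp: kernel_sets_def)
      show "?f T \<in> kernel_sets ?V M"
      proof (cases "y \<in> T")
        case True
        then show ?thesis using T ker_iff[OF T(1)] by (auto simp: kernel_sets_def)
      next
        case False
        then show ?thesis using T ker_iff'[OF T(1)] by (auto simp: kernel_sets_def)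
      qed
    qed
  qed
  then show ?thesis
    by (rule gf2_rank_of_kernel_bij[rotated 2]) (use assms(1-4) in auto)
qed

text \<open>
  Now the row of \<open>x\<close> says that \<open>y\<close> is in no null set, while the row of \<open>y\<close> determines whether \<open>x\<close>
  is. So a null set is the same as one of the graph without \<open>x\<close> and \<open>y\<close>, whatever the loop at \<open>y\<close>.
\<close>

lemma gf2_rank_unlooped_leaf:
  assumes "finite W" "x \<notin> W" "y \<notin> W" "x \<noteq> y"
    and "M x x = 0" "M x y = 1" "M y x = 1"
    and "\<And>w. w \<in> W \<Longrightarrow> M x w = 0" "\<And>w. w \<in> W \<Longrightarrow> M w x = 0"
  shows "gf2_rank (insert x (insert y W)) M = gf2_rank W M + 2"
proof -
  let ?V = "insert x (insert y W)" 
  \<comment> \<open>Include \<open>x\<close> exactly when the row of \<open>y\<close> needs its contribution.\<close>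
  let ?f = "\<lambda>T. if sum (M y) T = 1 then insert x T else T"
  have fin: "finite T" if "T \<subseteq> insert y W" for T
    using finite_subset[OF that] assms(1) by simp
  have sum_x: "sum (M x) T = of_bool (y \<in> T)" if "T \<subseteq> insert y W" for T
  proof -
    have "sum (M x) T = (\<Sum>w\<in>T. if w = y then 1 else 0)"
      using that assms by (intro sum.cong) auto
    then show ?thesis using fin[OF that] by simp
  qed
  have sum_ins: "sum (M v) (insert x T) = M v x + sum (M v) T" if "T \<subseteq> insert y W" for v T
    using that fin[OF that] assms(2,4) by (subst sum.insert) auto
  have ker_iff: "(\<forall>v\<in>?V. sum (M v) (insert x T) = 0) \<longleftrightarrow>
      y \<notin> T \<and> sum (M y) T = 1 \<and> (\<forall>v\<in>W. sum (M v) T = 0)"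
    if T: "T \<subseteq> insert y W" for T
  proof -
    have "sum (M x) (insert x T) = 0 \<longleftrightarrow> y \<notin> T"
      by (simp add: sum_ins[OF T] sum_x[OF T] assms(5))
    moreover have "sum (M y) (insert x T) = 0 \<longleftrightarrow> sum (M y) T = 1"
      by (cases "sum (M y) T") (simp_all add: sum_ins[OF T] assms(7))
    moreover have "sum (M v) (insert x T) = sum (M v) T" if "v \<in> W" for v
      using that by (simp add: sum_ins[OF T] assms(9))
    ultimately show ?thesis by auto
  qed
  have ker_iff': "(\<forall>v\<in>?V. sum (M v) T = 0) \<longleftrightarrow>
      y \<notin> T \<and> sum (M y) T = 0 \<and> (\<forall>v\<in>W. sum (M v) T = 0)"
    if T: "T \<subseteq> insert y W" for T
    using sum_x[OF T] by auto
  have "bij_betw ?f (kernel_sets W M) (kernel_sets ?V M)"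
  proof (rule bij_betw_byWitness[where f' = "\<lambda>X. X - {x}"])
    show "\<forall>T\<in>kernel_sets W M. ?f T - {x} = T"
      using assms(2) by (auto simp: kernel_sets_def)
    have mem: "X - {x} \<in> kernel_sets W M \<and> ?f (X - {x}) = X" if X: "X \<in> kernel_sets ?V M" for X
    proof (cases "x \<in> X")
      case True
      then have "insert x (X - {x}) = X" "X - {x} \<subseteq> insert y W" using X by (auto simp: kernel_sets_def)
      then show ?thesis using X ker_iff[of "X - {x}"] by (auto simp: kernel_sets_def)
    next
      case False
      then have "X - {x} = X" "X \<subseteq> insert y W" using X by (auto simp: kernel_sets_def)
      then show ?thesis using X ker_iff'[of X] by (auto simp: kernel_sets_def)
    qed
    then show "\<forall>X\<in>kernel_sets ?V M. ?f (X - {x}) = X"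
      and "(\<lambda>X. X - {x}) ` kernel_sets ?V M \<subseteq> kernel_sets W M" by blast+
    show "?f ` kernel_sets W M \<subseteq> kernel_sets ?V M"
    proof (rule image_subsetI)
      fix T assume "T \<in> kernel_sets W M"
      then have T: "T \<subseteq> insert y W" "y \<notin> T" "\<forall>v\<in>W. sum (M v) T = 0" 
        using assms(3) by (auto simp: kernel_sets_def)
      show "?f T \<in> kernel_sets ?V M"
      proof (cases "sum (M y) T = 1")
        case True
        then show ?thesis using T ker_iff[OF T(1)] by (auto simp: kernel_sets_def)
      next
        case False
        then show ?thesis using T ker_iff'[OF T(1)] by (auto simp: kernel_sets_def)
      qed
    qed
  qed
  then show ?thesis
    by (rule gf2_rank_of_kernel_bij[rotated 2]) (use assms(1-4) in auto)
qed

lemma gf2_rank_looped_isolated: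
  assumes "finite W" "x \<notin> W" "M x x = 1"
    and "\<And>w. w \<in> W \<Longrightarrow> M x w = 0" "\<And>w. w \<in> W \<Longrightarrow> M w x = 0"
  shows "gf2_rank (insert x W) M = gf2_rank W M + 1"
proof -
  have sum_x: "sum (M x) X = of_bool (x \<in> X)" if "X \<subseteq> insert x W" for X
  proof -
    have "sum (M x) X = (\<Sum>w\<in>X. if w = x then 1 else 0)"
      using that assms by (intro sum.cong) auto
    then show ?thesis using finite_subset[OF that] assms(1) by simp
  qed
  have "kernel_sets (insert x W) M = kernel_sets W M"
  proof -
    have "X \<subseteq> insert x W \<and> (\<forall>v\<in>insert x W. sum (M v) X = 0)
        \<longleftrightarrow> X \<subseteq> W \<and> (\<forall>v\<in>W. sum (M v) X = 0)" for X
      using sum_x[of X] assms(2) by (cases "X \<subseteq> insert x W") auto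
    then show ?thesis unfolding kernel_sets_def by simp
  qed
  then have "bij_betw id (kernel_sets W M) (kernel_sets (insert x W) M)" by simp
  then show ?thesis
    by (rule gf2_rank_of_kernel_bij[rotated 2]) (use assms(1-2) in auto)
qed

text \<open>
  The column of \<open>x\<close> vanishes, so \<open>x\<close> may be added to or removed from any null set: their number
  doubles, which uses up the additional vertex.
\<close>

lemma gf2_rank_unlooped_isolated:
  assumes "finite W" "x \<notin> W" "M x x = 0"
    and "\<And>w. w \<in> W \<Longrightarrow> M x w = 0" "\<And>w. w \<in> W \<Longrightarrow> M w x = 0"
  shows "gf2_rank (insert x W) M = gf2_rank W M"
proof (rule gf2_rank_eqI)
  have x_free: "sum (M v) (X - {x}) = sum (M v) X" if "X \<subseteq> insert x W" "v \<in> insert x W" for X v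
    using that assms finite_subset[OF that(1)] by (cases "v = x") (auto simp: sum_diff1)
  have sum_x: "sum (M x) X = 0" if "X \<subseteq> insert x W" for X
    using that assms by (intro sum.neutral) auto
  have "kernel_sets (insert x W) M = kernel_sets W M \<union> insert x ` kernel_sets W M"
  proof (intro subset_antisym subsetI)
    fix X assume "X \<in> kernel_sets (insert x W) M"
    then have X: "X \<subseteq> insert x W" "\<forall>v\<in>insert x W. sum (M v) X = 0"
      by (auto simp: kernel_sets_def)
    have mem: "X - {x} \<in> kernel_sets W M"
      unfolding kernel_sets_def using X x_free[OF X(1)] by auto
    show "X \<in> kernel_sets W M \<union> insert x ` kernel_sets W M"
    proof (cases "x \<in> X")
      case True
      then have "X = insert x (X - {x})" by blast
      then show ?thesis using mem by (intro UnI2 image_eqI)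
    next
      case False
      then show ?thesis using mem by simp
    qed
  next
    fix X assume "X \<in> kernel_sets W M \<union> insert x ` kernel_sets W M"
    then obtain T where T: "T \<in> kernel_sets W M" "X - {x} = T" "X \<subseteq> insert x W"
      using assms(2) by (auto simp: kernel_sets_def)
    then have "sum (M v) X = 0" if "v \<in> insert x W" for v
      using x_free[OF T(3) that] sum_x[OF T(3)] that by (auto simp: kernel_sets_def)
    then show "X \<in> kernel_sets (insert x W) M" using T(3) by (simp add: kernel_sets_def)
  qed
  moreover have "card (kernel_sets W M \<union> insert x ` kernel_sets W M) = 2 * card (kernel_sets W M)"
  proof -
    have fin: "finite (kernel_sets W M)"
      by (rule finite_subset[of _ "Pow W"]) (use assms(1) in \<open>auto simp: kernel_sets_def\<close>)
    have no_x: "x \<notin> T" if "T \<in> kernel_sets W M" for T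
      using that assms(2) by (auto simp: kernel_sets_def)
    have "inj_on (insert x) (kernel_sets W M)"
      by (rule inj_onI) (use no_x in \<open>metis insert_ident\<close>)
    then show ?thesis
      using fin no_x by (subst card_Un_disjoint) (auto simp: card_image)
  qed
  ultimately show "card (kernel_sets (insert x W) M) * 2 ^ gf2_rank W M = 2 ^ card (insert x W)"
    using card_kernel_sets_gf2_rank[OF assms(1), of M] assms(1,2) by simp
qed

section \<open>Recursions for the partial Petrial polynomial\<close>

text \<open>
  The edge set \<open>E\<close> is kept fixed while vertices are deleted: only its edges inside \<open>V\<close> matter
  for the following polynomial, which is therefore that of the subgraph induced on \<open>V\<close>.
\<close>

definition looped_entry :: "'a set set \<Rightarrow> 'a set \<Rightarrow> 'a \<Rightarrow> 'a \<Rightarrow> bit" where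
  "looped_entry E L v w = (if v = w then of_bool (v \<in> L) else of_bool ({v, w} \<in> E))"

definition petrial_on :: "'a set set \<Rightarrow> 'a set \<Rightarrow> int poly" where
  "petrial_on E V = (\<Sum>L\<in>Pow V. monom 1 1 ^ gf2_rank V (looped_entry E L))"

lemma partial_petrial_poly_eq_petrial_on:
  assumes "distinct vs"
  shows "partial_petrial_poly vs E = petrial_on E (set vs)"
proof -
  let ?n = "length vs"
  have "?n - corank (looped_adj_mat vs E L) = gf2_rank (set vs) (looped_entry E L)" for L
  proof -
    let ?A = "looped_adj_mat vs E L"
    have "?A = mat ?n ?n (\<lambda>(i, j). looped_entry E L (vs ! i) (vs ! j))"
      using assms unfolding looped_adj_mat_def looped_entry_def
      by (intro eq_matI) (auto simp: nth_eq_iff_index_eq)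
    then have "gf2_rank (set vs) (looped_entry E L) = vec_space.rank ?n ?A"
      using gf2_rank_eq_rank[OF assms, of "looped_entry E L"] by simp
    moreover have A: "?A \<in> carrier_mat ?n ?n" by (simp add: looped_adj_mat_def)
    moreover have "vec_space.rank ?n ?A \<le> ?n" using vec_space.rank_le_nc[OF A] .
    ultimately show ?thesis by (simp add: corank_def)
  qed
  then show ?thesis
    by (simp add: partial_petrial_poly_def petrial_on_def monom_power)
qed

lemma sum_Pow_insert:
  assumes "finite A" "x \<notin> A"
  shows "(\<Sum>L\<in>Pow (insert x A). f L) = (\<Sum>L\<in>Pow A. f L + f (insert x L))"
proof -
  have "inj_on (insert x) (Pow A)"
  proof (rule inj_onI)
    fix S T assume "S \<in> Pow A" "T \<in> Pow A" and eq: "insert x S = insert x T"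
    then have "x \<notin> S" "x \<notin> T" using assms(2) by auto
    with eq show "S = T" by (simp add: insert_ident)
  qed
  then have "(\<Sum>L\<in>insert x ` Pow A. f L) = (\<Sum>L\<in>Pow A. f (insert x L))"
    by (simp add: sum.reindex)
  moreover have "Pow A \<inter> insert x ` Pow A = {}" using assms(2) by auto
  ultimately show ?thesis
    using assms(1) by (simp add: Pow_insert sum.union_disjoint sum.distrib)
qed

lemma looped_entry_insert_loop:
  "v \<noteq> x \<Longrightarrow> looped_entry E (insert x L) v w = looped_entry E L v w"
  by (auto simp: looped_entry_def)

lemma petrial_on_empty: "petrial_on E {} = 1"
proof -
  have "gf2_rank {} (looped_entry E {}) = 0"
    by (rule gf2_rank_eqI) (simp add: kernel_sets_def)
  then show ?thesis by (simp add: petrial_on_def)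
qed

lemma petrial_on_isolated:
  assumes "finite W" "x \<notin> W" "\<And>w. w \<in> W \<Longrightarrow> {x, w} \<notin> E"
  shows "petrial_on E (insert x W) = (1 + monom 1 1) * petrial_on E W"
proof -
  have "gf2_rank (insert x W) (looped_entry E L) = gf2_rank W (looped_entry E L)"
    if "L \<subseteq> W" for L
    by (rule gf2_rank_unlooped_isolated)
      (use assms that in \<open>auto simp: looped_entry_def insert_commute\<close>)
  moreover have "gf2_rank (insert x W) (looped_entry E (insert x L)) = gf2_rank W (looped_entry E L) + 1"
    if "L \<subseteq> W" for L
  proof -
    have "gf2_rank (insert x W) (looped_entry E (insert x L))
        = gf2_rank W (looped_entry E (insert x L)) + 1"
      by (rule gf2_rank_looped_isolated)
        (use assms that in \<open>auto simp: looped_entry_def insert_commute\<close>)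
    also have "gf2_rank W (looped_entry E (insert x L)) = gf2_rank W (looped_entry E L)"
      by (intro gf2_rank_cong looped_entry_insert_loop) (use assms(2) in auto)
    finally show ?thesis .
  qed
  ultimately show ?thesis
    unfolding petrial_on_def sum_Pow_insert[OF assms(1,2)]
    by (simp add: sum_distrib_left distrib_right)
qed

text \<open>
  Without a loop at the leaf \<open>x\<close> both \<open>x\<close> and \<open>y\<close> disappear at the price of rank 2, once for each
  of the two loop states of \<open>y\<close>; this gives the factor 2. With a loop at \<open>x\<close> the loop at \<open>y\<close> is
  toggled, which only permutes the loop sets of the remaining graph.
\<close>

lemma petrial_on_leaf:
  assumes "finite W" "x \<notin> W" "y \<notin> W" "x \<noteq> y"
    and "{x, y} \<in> E" "\<And>w. w \<in> W \<Longrightarrow> {x, w} \<notin> E"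
  shows "petrial_on E (insert x (insert y W))
       = monom 1 1 * petrial_on E (insert y W) + 2 * monom 1 1 ^ 2 * petrial_on E W"
proof -
  let ?V = "insert x (insert y W)"
  let ?z = "monom 1 1 :: int poly"
  have unlooped: "gf2_rank ?V (looped_entry E L) = gf2_rank W (looped_entry E (L - {y})) + 2"
    if "L \<subseteq> insert y W" for L
  proof -
    have "gf2_rank ?V (looped_entry E L) = gf2_rank W (looped_entry E L) + 2"
      by (rule gf2_rank_unlooped_leaf)
        (use assms that in \<open>auto simp: looped_entry_def insert_commute\<close>)
    also have "gf2_rank W (looped_entry E L) = gf2_rank W (looped_entry E (L - {y}))"
      by (rule gf2_rank_cong) (use assms(3) in \<open>auto simp: looped_entry_def\<close>)
    finally show ?thesis .
  qed
  have looped: "gf2_rank ?V (looped_entry E (insert x L))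
      = gf2_rank (insert y W) (looped_entry E (if y \<in> L then L - {y} else insert y L)) + 1"
    if "L \<subseteq> insert y W" for L
  proof -
    have "gf2_rank ?V (looped_entry E (insert x L)) = gf2_rank (insert y W)
        (\<lambda>v w. looped_entry E (insert x L) v w + of_bool (v = y \<and> w = y)) + 1"
      by (rule gf2_rank_looped_leaf)
        (use assms that in \<open>auto simp: looped_entry_def insert_commute\<close>)
    also have "gf2_rank (insert y W) (\<lambda>v w. looped_entry E (insert x L) v w + of_bool (v = y \<and> w = y))
        = gf2_rank (insert y W) (looped_entry E (if y \<in> L then L - {y} else insert y L))"
      by (rule gf2_rank_cong) (use assms(2-4) in \<open>auto simp: looped_entry_def\<close>)
    finally show ?thesis .
  qed
  have y_free: "y \<notin> L" "insert y L - {y} = L" "L - {y} = L" if "L \<in> Pow W" for L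
    using that assms(3) by auto
  have "petrial_on E ?V
      = (\<Sum>L\<in>Pow (insert y W). ?z ^ gf2_rank ?V (looped_entry E L)
          + ?z ^ gf2_rank ?V (looped_entry E (insert x L)))"
    unfolding petrial_on_def by (rule sum_Pow_insert) (use assms in auto)
  also have "\<dots> = (\<Sum>L\<in>Pow (insert y W). ?z ^ (gf2_rank W (looped_entry E (L - {y})) + 2)
      + ?z ^ (gf2_rank (insert y W) (looped_entry E (if y \<in> L then L - {y} else insert y L)) + 1))"
    by (intro sum.cong refl) (simp only: unlooped looped Pow_iff)
  also have "\<dots> = (\<Sum>L\<in>Pow W. 2 * ?z ^ 2 * ?z ^ gf2_rank W (looped_entry E L)
      + ?z * (?z ^ gf2_rank (insert y W) (looped_entry E L)
        + ?z ^ gf2_rank (insert y W) (looped_entry E (insert y L))))"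
    unfolding sum_Pow_insert[OF assms(1,3)]
    by (intro sum.cong refl) (simp add: y_free algebra_simps power2_eq_square)
  also have "\<dots> = ?z * petrial_on E (insert y W) + 2 * ?z ^ 2 * petrial_on E W"
    unfolding petrial_on_def sum_Pow_insert[OF assms(1,3)]
    by (simp add: sum.distrib sum_distrib_left algebra_simps)
  finally show ?thesis .
qed

section \<open>Pendant paths\<close>

text \<open>
  Starting from \<open>W\<close>, the vertices of the list are added one by one, each adjacent among the vertices
  present to its predecessor only, and the first one to \<open>u\<close> only. The vertex \<open>u\<close> may lie outside
  \<open>W\<close>; then the list is a path not joined to \<open>W\<close>. Deleting \<open>u\<close> thus turns the first situation
  into the second one.
\<close>

fun pendant_path :: "'a set set \<Rightarrow> 'a set \<Rightarrow> 'a \<Rightarrow> 'a list \<Rightarrow> bool" where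
  "pendant_path E W u [] = True"
| "pendant_path E W u (x # xs) =
     (x \<notin> W \<and> (\<forall>w\<in>W. {x, w} \<in> E \<longleftrightarrow> w = u) \<and> pendant_path E (insert x W) x xs)"

lemma pendant_path_mono:
  "pendant_path E W u p \<Longrightarrow> W' \<subseteq> W \<Longrightarrow> pendant_path E W' u p"
proof (induction p arbitrary: W W' u)
  case (Cons x xs)
  then have "pendant_path E (insert x W') x xs" by (auto intro: Cons.IH[of "insert x W" x "insert x W'"])
  with Cons.prems show ?case by auto
qed simp

lemma pendant_path_disjoint: "pendant_path E W u p \<Longrightarrow> set p \<inter> W = {}"
proof (induction p arbitrary: W u)
  case (Cons x xs)
  then have "set xs \<inter> insert x W = {}" using Cons.IH[of "insert x W" x] by simp
  with Cons.prems show ?case by auto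
qed simp

lemma path_edges_Cons: "path_edges (x # y # xs) = insert {x, y} (path_edges (y # xs))"
proof -
  have "path_edges (x # y # xs) = (\<lambda>i. {(x # y # xs) ! i, (y # xs) ! i}) ` {i. i < Suc (length xs)}"
    unfolding path_edges_def by auto
  also have "{i. i < Suc (length xs)} = insert 0 (Suc ` {i. i < length xs})"
    by (auto simp: image_iff less_Suc_eq_0_disj)
  also have "(\<lambda>i. {(x # y # xs) ! i, (y # xs) ! i}) ` \<dots> = insert {x, y} (path_edges (y # xs))"
    unfolding path_edges_def by (auto simp: image_image)
  finally show ?thesis .
qed

lemma path_edges_subset: "e \<in> path_edges xs \<Longrightarrow> e \<subseteq> set xs"
  unfolding path_edges_def by auto

text \<open>
  The bridge from edge sets: the path edges are the only ones that touch the new vertices.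
\<close>

lemma pendant_pathI:
  assumes "E = F \<union> path_edges (u # p)" "\<And>e. e \<in> F \<Longrightarrow> e \<inter> set p = {}"
    and "distinct (u # p)" "W \<inter> set p = {}"
  shows "pendant_path E W u p"
  using assms
proof (induction p arbitrary: W F u)
  case (Cons x xs)
  have E: "E = F \<union> insert {u, x} (path_edges (x # xs))"
    using Cons.prems(1) by (simp add: path_edges_Cons)
  have "w = u" if w: "w \<in> W" "{x, w} \<in> E" for w
  proof -
    have "{x, w} \<notin> F" using Cons.prems(2)[of "{x, w}"] by auto
    moreover have "{x, w} \<notin> path_edges (x # xs)"
      using path_edges_subset[of "{x, w}" "x # xs"] w(1) Cons.prems(4) by auto
    ultimately have "{x, w} = {u, x}" using w(2) E by blast
    then show ?thesis using Cons.prems(3) by (auto simp: doubleton_eq_iff)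
  qed
  moreover have "{x, u} \<in> E" using E by (simp add: insert_commute)
  moreover have "pendant_path E (insert x W) x xs"
  proof (rule Cons.IH)
    show "E = insert {u, x} F \<union> path_edges (x # xs)" using E by auto
    show "e \<inter> set xs = {}" if "e \<in> insert {u, x} F" for e
      using that Cons.prems(2)[of e] Cons.prems(3) by auto
  qed (use Cons.prems in auto)
  ultimately show ?case using Cons.prems(4) by auto
qed simp

text \<open>
  Induction from the attached end: the path behind its first vertex \<open>x\<close> hangs at \<open>x\<close>, and
  deleting \<open>x\<close> leaves \<open>W\<close>, while \<open>x\<close> alone is a leaf at \<open>u\<close>. The coefficients then satisfy
  the Jacobsthal recursion.
\<close>

lemma petrial_on_pendant_path:
  assumes "finite W" "u \<in> W" "pendant_path E W u p"
  shows "petrial_on E (W \<union> set p)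
       = monom 1 1 ^ length p * (of_int (jacobsthal (length p + 1)) * petrial_on E W
           + 2 * of_int (jacobsthal (length p)) * monom 1 1 * petrial_on E (W - {u}))"
  using assms
proof (induction p arbitrary: W u)
  case (Cons x xs)
  have x: "x \<notin> W" "pendant_path E (insert x W) x xs" using Cons.prems by auto
  \<comment> \<open>The leaf rule wants the neighbour \<open>u\<close> split off from \<open>W\<close>.\<close>
  have "petrial_on E (insert x (insert u (W - {u})))
      = monom 1 1 * petrial_on E (insert u (W - {u})) + 2 * monom 1 1 ^ 2 * petrial_on E (W - {u})"
    by (rule petrial_on_leaf) (use Cons.prems in auto)
  then have leaf: "petrial_on E (insert x W)
      = monom 1 1 * petrial_on E W + 2 * monom 1 1 ^ 2 * petrial_on E (W - {u})"
    using Cons.prems(2) by (simp add: insert_absorb)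
  have "petrial_on E (W \<union> set (x # xs)) = petrial_on E (insert x W \<union> set xs)" by simp
  also have "\<dots> = monom 1 1 ^ length xs * (of_int (jacobsthal (length xs + 1)) * petrial_on E (insert x W)
      + 2 * of_int (jacobsthal (length xs)) * monom 1 1 * petrial_on E (insert x W - {x}))"
    by (rule Cons.IH) (use Cons.prems x in auto)
  also have "insert x W - {x} = W" using x(1) by simp
  finally show ?case unfolding leaf by (simp add: algebra_simps power2_eq_square)
qed simp

text \<open>
  The factor is the polynomial of a path on \<open>length p\<close> vertices, so this is multiplicativity over
  components in the one case that occurs.
\<close>

lemma petrial_on_detached_path:
  assumes "finite W" "u \<notin> W" "pendant_path E W u p" "p \<noteq> []"
  shows "petrial_on E (W \<union> set p)
       = monom 1 1 ^ (length p - 1) * (of_int (jacobsthal (length p + 1)) * monom 1 1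
           + of_int (jacobsthal (length p))) * petrial_on E W"
proof -
  obtain x xs where p: "p = x # xs" using assms(4) by (cases p) auto
  have x: "x \<notin> W" "pendant_path E (insert x W) x xs" and "\<forall>w\<in>W. {x, w} \<notin> E"
    using assms p by auto
  then have isolated: "petrial_on E (insert x W) = (1 + monom 1 1) * petrial_on E W"
    using assms(1) by (intro petrial_on_isolated) auto
  have "petrial_on E (W \<union> set p) = petrial_on E (insert x W \<union> set xs)" by (simp add: p)
  also have "\<dots> = monom 1 1 ^ length xs * (of_int (jacobsthal (length xs + 1)) * petrial_on E (insert x W)
      + 2 * of_int (jacobsthal (length xs)) * monom 1 1 * petrial_on E (insert x W - {x}))"
    by (rule petrial_on_pendant_path) (use assms x in auto)
  also have "insert x W - {x} = W" using x(1) by simp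
  finally show ?thesis unfolding isolated by (simp add: p algebra_simps)
qed

section \<open>Two pendant paths at each end of an edge\<close>

lemma jacobsthal_add:
  "jacobsthal (m + n + 1) = jacobsthal (m + 1) * jacobsthal (n + 1) + 2 * jacobsthal m * jacobsthal n"
  by (induction m rule: jacobsthal.induct) (simp_all add: algebra_simps)

text \<open>
  In the deletion term of the path \<open>p\<close> the vertex \<open>u\<close> is gone, so that \<open>q\<close> is a separate component.
  By the addition formula, the coefficients collapse to Jacobsthal numbers of \<open>a + b\<close>, corrected by
  the product \<open>m\<close> that stays with \<open>W\<close>.
\<close>

lemma petrial_on_two_pendant_paths:
  fixes E :: "'a set set"
  assumes "finite W" "u \<in> W" "pendant_path E (W \<union> set q) u p" "pendant_path E W u q" "q \<noteq> []"
  defines "a \<equiv> length p" and "b \<equiv> length q"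
  defines "m \<equiv> jacobsthal (a + 1) * jacobsthal (b + 1)"
  shows "petrial_on E (W \<union> set p \<union> set q) = monom 1 1 ^ (a + b) *
      (of_int m * petrial_on E W
       + (of_int (jacobsthal (a + b + 2) - m) * monom 1 1 + of_int (jacobsthal (a + b + 1) - m))
         * petrial_on E (W - {u}))"
proof -
  let ?z = "monom 1 1 :: int poly"
  obtain b' where b': "b = Suc b'" using assms(5) unfolding b_def by (cases q) auto
  have "u \<notin> set q"
    using pendant_path_disjoint[OF assms(4)] assms(2) by blast
  then have minus: "W \<union> set q - {u} = (W - {u}) \<union> set q" by auto
  have "petrial_on E (W \<union> set q \<union> set p)
      = ?z ^ a * (of_int (jacobsthal (a + 1)) * petrial_on E (W \<union> set q)
           + 2 * of_int (jacobsthal a) * ?z * petrial_on E ((W - {u}) \<union> set q))"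
    using petrial_on_pendant_path[of "W \<union> set q" u E p] assms(1-3)
    by (simp add: a_def minus)
  also have "petrial_on E (W \<union> set q) = ?z ^ b * (of_int (jacobsthal (b + 1)) * petrial_on E W
           + 2 * of_int (jacobsthal b) * ?z * petrial_on E (W - {u}))"
    using petrial_on_pendant_path[OF assms(1,2,4)] by (simp add: b_def)
  also have "petrial_on E ((W - {u}) \<union> set q)
      = ?z ^ (b - 1) * (of_int (jacobsthal (b + 1)) * ?z + of_int (jacobsthal b)) * petrial_on E (W - {u})"
    using petrial_on_detached_path[of "W - {u}" u E q] assms(1,5) pendant_path_mono[OF assms(4)]
    by (simp add: b_def)
  finally have "petrial_on E (W \<union> set p \<union> set q) = ?z ^ (a + b) *
      (of_int m * petrial_on E W
       + (of_int (2 * jacobsthal (a + 1) * jacobsthal b + 2 * jacobsthal a * jacobsthal (b + 1)) * ?z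
          + of_int (2 * jacobsthal a * jacobsthal b)) * petrial_on E (W - {u}))"
    unfolding b' m_def by (simp add: algebra_simps power_add Un_ac)
  also have "2 * jacobsthal (a + 1) * jacobsthal b + 2 * jacobsthal a * jacobsthal (b + 1)
      = jacobsthal (a + b + 2) - m"
    using jacobsthal_add[of a "b + 1"] by (simp add: m_def algebra_simps)
  also have "2 * jacobsthal a * jacobsthal b = jacobsthal (a + b + 1) - m"
    using jacobsthal_add[of a b] by (simp add: m_def)
  finally show ?thesis .
qed

theorem theorem23:
  fixes a b c d n :: nat
    and V :: "'a set" and E :: "'a set set" and vs :: "'a list"
    and A B C :: int
  assumes "a \<ge> 1" and "b \<ge> 1" and "c \<ge> 1" and "d \<ge> 1"
    and "n = a + b + c + d + 2"
    and "H_shape a b c d V E"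
    and "distinct vs" and "set vs = V"
    and "A = jacobsthal (a + b + 2) * jacobsthal (c + d + 2)
           + 2 * jacobsthal (a + 1) * jacobsthal (b + 1) * jacobsthal (c + 1) * jacobsthal (d + 1)"
    and "B = jacobsthal (a + b + 1) * jacobsthal (c + d + 2)
           + jacobsthal (a + b + 2) * jacobsthal (c + d + 1)
           - jacobsthal (a + 1) * jacobsthal (b + 1) * jacobsthal (c + 1) * jacobsthal (d + 1)"
    and "C = jacobsthal (a + b + 1) * jacobsthal (c + d + 1)
           - jacobsthal (a + 1) * jacobsthal (b + 1) * jacobsthal (c + 1) * jacobsthal (d + 1)"
  shows "partial_petrial_poly vs E = monom A n + monom B (n - 1) + monom C (n - 2)"
proof -
  let ?z = "monom 1 1 :: int poly"
  from assms(6) obtain u v p q r s where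
    len: "length p = a" "length q = b" "length r = c" "length s = d" and
    dist: "distinct (u # v # p @ q @ r @ s)" and V: "V = set (u # v # p @ q @ r @ s)" and
    E: "E = {{u, v}} \<union> path_edges (u # p) \<union> path_edges (u # q)
                     \<union> path_edges (v # r) \<union> path_edges (v # s)"
    unfolding H_shape_def by blast
  have nonempty: "q \<noteq> []" "s \<noteq> []" using len assms(2,4) by auto
  have path_vertex: "y = x \<or> y \<in> set xs" if "e \<in> path_edges (x # xs)" "y \<in> e" for e x xs y
    using path_edges_subset[OF that(1)] that(2) by auto
  \<comment> \<open>The paths are peeled off in the order \<open>p\<close>, \<open>q\<close>, \<open>r\<close>, \<open>s\<close>; each is pendant on what is left.\<close>
  have P: "pendant_path E ({u, v} \<union> set r \<union> set s \<union> set q) u p"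
    by (rule pendant_pathI[where F = "{{u, v}} \<union> path_edges (u # q)
          \<union> path_edges (v # r) \<union> path_edges (v # s)"])
      (use dist E in \<open>auto simp: disjoint_iff dest!: path_vertex\<close>)
  have Q: "pendant_path E ({u, v} \<union> set r \<union> set s) u q"
    by (rule pendant_pathI[where F = "{{u, v}} \<union> path_edges (u # p)
          \<union> path_edges (v # r) \<union> path_edges (v # s)"])
      (use dist E in \<open>auto simp: disjoint_iff dest!: path_vertex\<close>)
  have R: "pendant_path E ({u, v} \<union> set s) v r"
    by (rule pendant_pathI[where F = "{{u, v}} \<union> path_edges (u # p)
          \<union> path_edges (u # q) \<union> path_edges (v # s)"])
      (use dist E in \<open>auto simp: disjoint_iff dest!: path_vertex\<close>)
  have S: "pendant_path E {u, v} v s"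
    by (rule pendant_pathI[where F = "{{u, v}} \<union> path_edges (u # p)
          \<union> path_edges (u # q) \<union> path_edges (v # r)"])
      (use dist E in \<open>auto simp: disjoint_iff dest!: path_vertex\<close>)
  have R': "pendant_path E ({v} \<union> set s) v r" using R by (rule pendant_path_mono) auto
  have S': "pendant_path E {v} v s" using S by (rule pendant_path_mono) auto
  have uv: "u \<noteq> v" "{u, v} \<in> E" using dist E by auto
  have single: "petrial_on E {x} = 1 + ?z" for x
    using petrial_on_isolated[of "{}" x E] by (simp add: petrial_on_empty)
  have edge: "petrial_on E {u, v} = ?z * (1 + ?z) + 2 * ?z ^ 2"
    using petrial_on_leaf[of "{}" u v E] uv by (simp add: petrial_on_empty single)
  let ?m = "jacobsthal (a + 1) * jacobsthal (b + 1)"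
  let ?m' = "jacobsthal (c + 1) * jacobsthal (d + 1)"
  let ?l = "of_int (jacobsthal (a + b + 2) - ?m) * ?z + of_int (jacobsthal (a + b + 1) - ?m)"
  let ?l' = "of_int (jacobsthal (c + d + 2) - ?m') * ?z + of_int (jacobsthal (c + d + 1) - ?m')"
  have "petrial_on E V = petrial_on E (({u, v} \<union> set r \<union> set s) \<union> set p \<union> set q)"
    unfolding V by (rule arg_cong[of _ _ "petrial_on E"]) auto
  also have "\<dots> = ?z ^ (a + b) * (of_int ?m * petrial_on E ({u, v} \<union> set r \<union> set s)
      + ?l * petrial_on E (({u, v} \<union> set r \<union> set s) - {u}))"
    using petrial_on_two_pendant_paths[OF _ _ P Q nonempty(1)] by (simp add: len)
  also have "({u, v} \<union> set r \<union> set s) - {u} = {v} \<union> set r \<union> set s"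
    using dist by auto
  also have "petrial_on E ({u, v} \<union> set r \<union> set s) = ?z ^ (c + d) * (of_int ?m' * petrial_on E {u, v}
      + ?l' * petrial_on E ({u, v} - {v}))"
    using petrial_on_two_pendant_paths[OF _ _ R S nonempty(2)] by (simp add: len)
  also have "{u, v} - {v} = {u}" using uv by auto
  also have "petrial_on E ({v} \<union> set r \<union> set s) = ?z ^ (c + d) * (of_int ?m' * petrial_on E {v}
      + ?l' * petrial_on E ({v} - {v}))"
    using petrial_on_two_pendant_paths[OF _ _ R' S' nonempty(2)] by (simp add: len)
  also have "?z ^ (a + b) * (of_int ?m * (?z ^ (c + d) * (of_int ?m' * petrial_on E {u, v}
        + ?l' * petrial_on E {u}))
      + ?l * (?z ^ (c + d) * (of_int ?m' * petrial_on E {v} + ?l' * petrial_on E ({v} - {v}))))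
    = ?z ^ (a + b + c + d) * (of_int A * ?z ^ 2 + of_int B * ?z + of_int C)"
  proof -
    \<comment> \<open>All Jacobsthal numbers are opaque here: \<open>h, k\<close> stand for those of \<open>a + b + 2\<close> and
      \<open>a + b + 1\<close>, primes for the end \<open>v\<close>, and \<open>y, y'\<close> for the powers of \<open>z\<close>.\<close>
    have expand: "y * (m * (y' * (m' * (z * (1 + z) + 2 * z ^ 2) + ((h' - m') * z + (k' - m')) * (1 + z)))
          + ((h - m) * z + (k - m)) * (y' * (m' * (1 + z) + ((h' - m') * z + (k' - m')) * 1)))
        = y * y' * ((h * h' + 2 * (m * m')) * z ^ 2 + (k * h' + h * k' - m * m') * z + (k * k' - m * m'))"
      for y y' z m m' h h' k k' :: "int poly"
      by (simp add: algebra_simps power2_eq_square)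
    have coeffs: "A = jacobsthal (a + b + 2) * jacobsthal (c + d + 2) + 2 * (?m * ?m')"
      "B = jacobsthal (a + b + 1) * jacobsthal (c + d + 2)
         + jacobsthal (a + b + 2) * jacobsthal (c + d + 1) - ?m * ?m'"
      "C = jacobsthal (a + b + 1) * jacobsthal (c + d + 1) - ?m * ?m'"
      unfolding assms(9-11) by (simp_all only: mult.assoc)
    have "?z ^ (a + b + c + d) = ?z ^ (a + b) * ?z ^ (c + d)"
      by (simp add: power_add mult.assoc)
    then show ?thesis
      unfolding edge single Diff_cancel petrial_on_empty coeffs of_int_diff of_int_add
        of_int_mult[of 2] of_int_numeral of_int_mult[of "jacobsthal (a + b + 2)"]
        of_int_mult[of "jacobsthal (a + b + 1)"] of_int_mult[of ?m ?m']
      by (simp only: expand)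
  qed
  also have "\<dots> = monom A n + monom B (n - 1) + monom C (n - 2)"
  proof -
    have monom: "monom k i = of_int k * ?z ^ i" for k i
      by (simp add: monom_power of_int_poly smult_monom)
    have "monom A n = of_int A * ?z ^ (a + b + c + d + 2)"
      "monom B (n - 1) = of_int B * ?z ^ (a + b + c + d + 1)"
      "monom C (n - 2) = of_int C * ?z ^ (a + b + c + d)"
      unfolding monom[symmetric] using assms(5) by simp_all
    then show ?thesis by (simp only: power_add power_one_right distrib_left mult_ac)
  qed
  finally show ?thesis
    using partial_petrial_poly_eq_petrial_on[OF assms(7)] assms(8) by simp
qed

end
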